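(* Let $E$ be a complex Banach lattice, let $(e^{tA})_{t\ge 0}$ be a uniformly eventually positive analytic $C_0$-semigroup on $E$, and choose $t_0\in[0,\infty)$ such that $e^{tA}\ge 0$ for all $t\ge t_0$. If $(e^{tA})_{t\ge 0}$ is irreducible (or, equivalently in this situation, persistently irreducible), then for every $0\lneq f\in E$ and all $t>2t_0$ the vector $e^{tA}f$ is a quasi-interior point of $E_+$.
   Context: Notation: $E_+$ is the positive cone; $f\gneq 0$ (or $0 \lneq f$) means $f\ge 0$ and $f\ne 0$; $T\ge 0$ for a bounded operator $T$ means $T(E_+)\subseteq E_+$. A $C_0$-semigroup is uniformly eventually positive if there exists $t_0\ge0$ such that $e^{tA}\ge 0$ for all $t\ge t_0$. A vector $u\in E_+$ is a quasi-interior point of $E_+$ if the principal ideal $E_u=\{f\in E:\ |f|\le cu\text{ for some }c>0\}$ is dense in $E$. A $C_0$-semigroup $(e^{tA})_{t\ge0}$ on $E$ is irreducible if no closed ideal $I$ of $E$ other than $\{0\}$ and $E$ satisfies $e^{tA}I\subseteq I$ for all $t\ge 0$. It is persistently irreducible if no closed ideal $I$ other than $\{0\}$ and $E$ satisfies: there is $s_0\ge0$ with $e^{tA}I\subseteq I$ for all $t\ge s_0$. *)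

theory Defs
  imports "HOL-Analysis.Analysis"
begin

class complex_normed_vector = real_normed_vector +
  fixes scaleC :: "complex \<Rightarrow> 'a \<Rightarrow> 'a" (infixr \<open>*\<^sub>C\<close> 75)
  assumes scaleC_of_real: "complex_of_real r *\<^sub>C x = r *\<^sub>R x"
    and scaleC_add_right: "c *\<^sub>C (x + y) = c *\<^sub>C x + c *\<^sub>C y"
    and scaleC_add_left: "(c + d) *\<^sub>C x = c *\<^sub>C x + d *\<^sub>C x"
    and scaleC_scaleC: "c *\<^sub>C d *\<^sub>C x = (c * d) *\<^sub>C x"
    and norm_scaleC: "norm (c *\<^sub>C x) = cmod c * norm x"

text \<open>A complex Banach lattice \<open>E\<close> is the complexification of a real Banach lattice, with
  modulus \<open>|z| = sup {Re (c z) | cmod c = 1}\<close> and norm \<open>\<parallel>z\<parallel> = \<parallel> |z| \<parallel>\<close>. The decomposition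
  \<open>E = E\<^sub>R \<oplus> i E\<^sub>R\<close> is encoded by the conjugation \<open>vcnj\<close>: the real part \<open>E\<^sub>R\<close> is the set of its
  fixed points, and \<open>(1/2) (z + vcnj z)\<close> is the real part of \<open>z\<close>. The order is that of \<open>E\<^sub>R\<close>,
  extended to \<open>E\<close> by letting \<open>x \<le> y\<close> mean that \<open>y - x\<close> lies in the positive cone
  \<open>E\<^sub>+ \<subseteq> E\<^sub>R\<close>; it is a lattice order on \<open>E\<^sub>R\<close> only. Since \<open>vcnj\<close> is isometric by the axioms,
  \<open>E\<^sub>R\<close> is closed, hence complete.\<close>

class complex_banach_lattice = complex_normed_vector + banach + ordered_real_vector +
  fixes vcnj :: "'a \<Rightarrow> 'a"
    and modulus :: "'a \<Rightarrow> 'a"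
  assumes vcnj_add: "vcnj (x + y) = vcnj x + vcnj y"
    and vcnj_scaleC: "vcnj (c *\<^sub>C x) = cnj c *\<^sub>C vcnj x"
    and vcnj_vcnj: "vcnj (vcnj x) = x"
    and vcnj_nonneg: "0 \<le> x \<Longrightarrow> vcnj x = x"
    and real_sup_exists:
      "vcnj x = x \<Longrightarrow> vcnj y = y \<Longrightarrow> \<exists>s. x \<le> s \<and> y \<le> s \<and> (\<forall>u. x \<le> u \<longrightarrow> y \<le> u \<longrightarrow> s \<le> u)"
    and modulus_upper:
      "cmod c = 1 \<Longrightarrow> (1/2) *\<^sub>R (c *\<^sub>C z + vcnj (c *\<^sub>C z)) \<le> modulus z"
    and modulus_least:
      "(\<And>c. cmod c = 1 \<Longrightarrow> (1/2) *\<^sub>R (c *\<^sub>C z + vcnj (c *\<^sub>C z)) \<le> u) \<Longrightarrow> modulus z \<le> u"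
    and norm_modulus: "norm (modulus z) = norm z"
    and norm_mono_nonneg: "0 \<le> x \<Longrightarrow> x \<le> y \<Longrightarrow> norm x \<le> norm y"

text \<open>The scalar field, with the order of \<^theory>\<open>HOL-Library.Complex_Order\<close>, is an instance.\<close>

instantiation complex :: complex_banach_lattice
begin

definition "scaleC_complex (c::complex) (x::complex) = c * x"
definition "vcnj_complex (x::complex) = cnj x"
definition "modulus_complex (x::complex) = complex_of_real (cmod x)"

instance
proof
  fix z u :: complex
  assume H: "\<And>c. cmod c = 1 \<Longrightarrow> (1/2) *\<^sub>R (c *\<^sub>C z + vcnj (c *\<^sub>C z)) \<le> u"
  show "modulus z \<le> u"
  proof (cases "z = 0")
    case True then show ?thesis using H[of 1]
      by (auto simp: less_eq_complex_def modulus_complex_def scaleC_complex_def vcnj_complex_def)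
  next
    case False
    have e: "cnj z / cmod z * z = cmod z" using False
      by (simp add: field_simps complex_norm_square power2_eq_square flip: of_real_mult)
         (metis complex_norm_square power2_eq_square)
    have "cmod (cnj z / cmod z) = 1" using False by (simp add: norm_divide)
    from H[OF this] show ?thesis unfolding scaleC_complex_def e
      by (auto simp: less_eq_complex_def modulus_complex_def vcnj_complex_def)
  qed
next
  fix c :: complex and z :: complex assume c: "cmod c = 1"
  have "Re (c*z) \<le> cmod z" using complex_Re_le_cmod[of "c*z"] c by (simp add: norm_mult)
  then show "(1/2) *\<^sub>R (c *\<^sub>C z + vcnj (c *\<^sub>C z)) \<le> modulus z"
    by (subst less_eq_complex_def) (simp add: modulus_complex_def vcnj_complex_def scaleC_complex_def)
next
  fix x y :: complex assume "vcnj x = x" "vcnj y = y"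
  then have "Im x = 0" "Im y = 0" by (auto simp: vcnj_complex_def complex_eq_iff)
  then show "\<exists>s. x \<le> s \<and> y \<le> s \<and> (\<forall>u. x \<le> u \<longrightarrow> y \<le> u \<longrightarrow> s \<le> u)"
    by (intro exI[of _ "of_real (max (Re x) (Re y))"]) (auto simp: less_eq_complex_def)
next
  fix x y :: complex assume "0 \<le> x" "x \<le> y"
  then show "norm x \<le> norm y" by (auto simp: less_eq_complex_def cmod_def)
qed (auto simp: scaleC_complex_def less_eq_complex_def vcnj_complex_def modulus_complex_def
   complex_eq_iff norm_mult algebra_simps mult_left_mono scaleR_conv_of_real)

end

definition lattice_ideal :: "'a::complex_banach_lattice set \<Rightarrow> bool" where
  "lattice_ideal I \<longleftrightarrow>
     0 \<in> I \<and> (\<forall>x\<in>I. \<forall>y\<in>I. x + y \<in> I) \<and> (\<forall>c. \<forall>x\<in>I. c *\<^sub>C x \<in> I) \<and>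
     (\<forall>x. \<forall>y\<in>I. modulus x \<le> modulus y \<longrightarrow> x \<in> I)"

definition principal_ideal :: "'a::complex_banach_lattice \<Rightarrow> 'a set" where
  "principal_ideal u = {f. \<exists>c>0. modulus f \<le> c *\<^sub>R u}"

definition quasi_interior :: "'a::complex_banach_lattice \<Rightarrow> bool" where
  "quasi_interior u \<longleftrightarrow> 0 \<le> u \<and> closure (principal_ideal u) = UNIV"

text \<open>Bounded operators are elements of \<^typ>\<open>'a \<Rightarrow>\<^sub>L 'a\<close>, which are only real linear; the operator
  norm is the same for real and complex scalars.\<close>

definition complex_linear :: "('a::complex_normed_vector \<Rightarrow>\<^sub>L 'a) \<Rightarrow> bool" where
  "complex_linear T \<longleftrightarrow> (\<forall>c x. blinfun_apply T (c *\<^sub>C x) = c *\<^sub>C blinfun_apply T x)"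

definition positive_operator :: "('a::complex_banach_lattice \<Rightarrow>\<^sub>L 'a) \<Rightarrow> bool" where
  "positive_operator T \<longleftrightarrow> (\<forall>x\<ge>0. 0 \<le> blinfun_apply T x)"

text \<open>In the following, \<open>T t\<close> stands for \<open>exp (t A)\<close>; only its values for \<open>t \<ge> 0\<close> matter.\<close>

definition C0_semigroup :: "(real \<Rightarrow> 'a::complex_normed_vector \<Rightarrow>\<^sub>L 'a) \<Rightarrow> bool" where
  "C0_semigroup T \<longleftrightarrow>
     (\<forall>t\<ge>0. complex_linear (T t)) \<and>
     T 0 = id_blinfun \<and>
     (\<forall>s\<ge>0. \<forall>t\<ge>0. T (s + t) = T s o\<^sub>L T t) \<and>
     (\<forall>x. ((\<lambda>t. blinfun_apply (T t) x) \<longlongrightarrow> x) (at_right 0))"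

definition sector :: "real \<Rightarrow> complex set" where
  "sector \<theta> = {z. z \<noteq> 0 \<and> \<bar>Arg z\<bar> < \<theta>}"

text \<open>Holomorphy with respect to the operator norm: the Frechet derivative exists and is complex
  linear in the increment.\<close>

definition holomorphic_operator_family ::
    "(complex \<Rightarrow> 'a::complex_normed_vector \<Rightarrow>\<^sub>L 'a) \<Rightarrow> complex set \<Rightarrow> bool" where
  "holomorphic_operator_family S \<Omega> \<longleftrightarrow>
     (\<forall>z\<in>\<Omega>. \<exists>D. (S has_derivative D) (at z) \<and>
        (\<forall>c h x. blinfun_apply (D (c * h)) x = c *\<^sub>C blinfun_apply (D h) x))"

definition analytic_C0_semigroup :: "(real \<Rightarrow> 'a::complex_normed_vector \<Rightarrow>\<^sub>L 'a) \<Rightarrow> bool" where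
  "analytic_C0_semigroup T \<longleftrightarrow> C0_semigroup T \<and>
     (\<exists>\<theta> S. 0 < \<theta> \<and> \<theta> \<le> pi / 2 \<and>
        (\<forall>t\<ge>0. S (complex_of_real t) = T t) \<and>
        (\<forall>z\<in>sector \<theta>. complex_linear (S z)) \<and>
        (\<forall>z\<in>sector \<theta>. \<forall>w\<in>sector \<theta>. S (z + w) = S z o\<^sub>L S w) \<and>
        holomorphic_operator_family S (sector \<theta>) \<and>
        (\<forall>\<theta>'. 0 < \<theta>' \<longrightarrow> \<theta>' < \<theta> \<longrightarrow>
           (\<forall>x. ((\<lambda>z. blinfun_apply (S z) x) \<longlongrightarrow> x) (at 0 within sector \<theta>'))))"

definition uniformly_eventually_positive ::
    "(real \<Rightarrow> 'a::complex_banach_lattice \<Rightarrow>\<^sub>L 'a) \<Rightarrow> bool" where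
  "uniformly_eventually_positive T \<longleftrightarrow> (\<exists>t\<^sub>0\<ge>0. \<forall>t\<ge>t\<^sub>0. positive_operator (T t))"

definition irreducible_semigroup ::
    "(real \<Rightarrow> 'a::complex_banach_lattice \<Rightarrow>\<^sub>L 'a) \<Rightarrow> bool" where
  "irreducible_semigroup T \<longleftrightarrow>
     (\<forall>I. lattice_ideal I \<longrightarrow> closed I \<longrightarrow>
        (\<forall>t\<ge>0. blinfun_apply (T t) ` I \<subseteq> I) \<longrightarrow> I = {0} \<or> I = UNIV)"

definition persistently_irreducible_semigroup ::
    "(real \<Rightarrow> 'a::complex_banach_lattice \<Rightarrow>\<^sub>L 'a) \<Rightarrow> bool" where
  "persistently_irreducible_semigroup T \<longleftrightarrow>
     (\<forall>I. lattice_ideal I \<longrightarrow> closed I \<longrightarrow>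
        (\<exists>s\<^sub>0\<ge>0. \<forall>t\<ge>s\<^sub>0. blinfun_apply (T t) ` I \<subseteq> I) \<longrightarrow> I = {0} \<or> I = UNIV)"

end

theory Submission
  imports Defs "HOL-Complex_Analysis.Conformal_Mappings"
begin

text \<open>By the identity theorem, an orbit of an analytic semigroup lies in a closed subspace as soon
  as it does so on a set of times with a positive accumulation point; this gives the equivalence
  of the two notions of irreducibility. Now put \<open>h = T t\<^sub>0 f\<close>, \<open>u = T t f\<close> and let \<open>J\<close> be the closed
  ideal generated by \<open>u\<close>. One approximates \<open>h\<close> by positive vectors \<open>g\<close> with \<open>g \<le> T (\<tau> n) h\<close> for a
  sequence of times \<open>\<tau> n\<close> tending to 0. Because \<open>t - t\<^sub>0 > t\<^sub>0\<close>, the operators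
  \<open>T (t - t\<^sub>0 - \<tau> n)\<close> are eventually positive and map \<open>g\<close> below \<open>u\<close>, hence into \<open>J\<close>. So the
  identity theorem puts the orbit of \<open>g\<close>, and in the limit that of \<open>h\<close>, into \<open>J\<close>. In particular
  \<open>T s u\<close> lies in \<open>J\<close> for all \<open>s\<close>, so \<open>J\<close> is invariant for \<open>s \<ge> t\<^sub>0\<close>, and \<open>J \<noteq> {0}\<close> because analyticity
  makes \<open>T t\<close> injective. Persistent irreducibility yields \<open>J = UNIV\<close>.\<close>

section \<open>Separation of a point from a closed subspace\<close>

text \<open>Homogeneity is stated as an inequality because that is what infima of such functionals
  inherit directly; applying it to the inverse scalar recovers equality.\<close>

definition sublinear :: "('a::real_vector \<Rightarrow> real) \<Rightarrow> bool" where
  "sublinear p \<longleftrightarrow>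
     (\<forall>x y. p (x + y) \<le> p x + p y) \<and> (\<forall>r\<ge>0. \<forall>x. p (r *\<^sub>R x) \<le> r * p x)"

lemma sublinear_add: "sublinear p \<Longrightarrow> p (x + y) \<le> p x + p y"
  and sublinear_scaleR_le: "sublinear p \<Longrightarrow> 0 \<le> r \<Longrightarrow> p (r *\<^sub>R x) \<le> r * p x"
  by (auto simp: sublinear_def)

lemma sublinear_zero: "sublinear p \<Longrightarrow> p 0 = 0"
  using sublinear_add[of p 0 0] sublinear_scaleR_le[of p 0 0] by simp

lemma sublinear_ge: "sublinear p \<Longrightarrow> - p (- x) \<le> p x"
  using sublinear_add[of p x "- x"] sublinear_zero[of p] by simp

lemma sublinear_scaleR:
  assumes "sublinear p" "0 \<le> r"
  shows "p (r *\<^sub>R x) = r * p x"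
proof (cases "r = 0")
  case False
  then have "p x \<le> inverse r * p (r *\<^sub>R x)"
    using sublinear_scaleR_le[OF assms(1), of "inverse r" "r *\<^sub>R x"] assms(2) by simp
  then have "r * p x \<le> p (r *\<^sub>R x)"
    using False assms(2) by (simp add: field_simps)
  then show ?thesis
    using sublinear_scaleR_le[OF assms, of x] by simp
qed (simp add: sublinear_zero assms)

text \<open>The infimum of \<open>p (x + t *\<^sub>R y) - t * p y\<close> over t \<ge> 0 is again
  sublinear; t = 0 gives \<open>q \<le> p\<close> and t = 1 the last bound. A minimal functional
  cannot shrink, which makes it superadditive and hence additive.\<close>

lemma sublinear_shrink:
  assumes p: "sublinear p"
  obtains q where "sublinear q" "q \<le> p" "\<And>x. q x \<le> p (x + y) - p y"
proof -
  define F where "F x t = p (x + t *\<^sub>R y) - t * p y" for x and t :: real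
  define q where "q x = (INF t\<in>{0..}. F x t)" for x
  \<comment> \<open>This bound does not depend on \<open>t\<close>, so the infimum is
    finite.\<close>
  have lower: "- p (- x) \<le> F x t" if "0 \<le> t" for x t
    using sublinear_add[OF p, of "x + t *\<^sub>R y" "- x"] sublinear_scaleR[OF p that, of y]
    by (simp add: F_def)
  have q_le: "q x \<le> F x t" if "0 \<le> t" for x t
    unfolding q_def using lower that by (intro cINF_lower bdd_belowI2[of _ "- p (- x)"]) auto
  have q_ge: "c \<le> q x" if "\<And>t. 0 \<le> t \<Longrightarrow> c \<le> F x t" for c x
    unfolding q_def using that by (intro cINF_greatest) auto
  have F_add: "F (x + z) (t + s) \<le> F x t + F z s" for x z t s
    using sublinear_add[OF p, of "x + t *\<^sub>R y" "z + s *\<^sub>R y"]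
    by (simp add: F_def algebra_simps)
  have F_scale: "F (r *\<^sub>R x) (r * t) \<le> r * F x t" if "0 \<le> r" for r x t
    using sublinear_scaleR_le[OF p that, of "x + t *\<^sub>R y"]
    by (simp add: F_def algebra_simps)
  have "sublinear q"
    unfolding sublinear_def
  proof (intro conjI allI impI)
    fix x z
    have "q (x + z) - F x t \<le> q z" if "0 \<le> t" for t
    proof (rule q_ge)
      fix s :: real assume "0 \<le> s"
      with that show "q (x + z) - F x t \<le> F z s"
        using q_le[of "t + s" "x + z"] F_add[of x z t s] by simp
    qed
    then have "q (x + z) - q z \<le> q x"
      by (intro q_ge) (simp add: algebra_simps)
    then show "q (x + z) \<le> q x + q z" by simp
  next
    fix r :: real and x assume r: "0 \<le> r"
    show "q (r *\<^sub>R x) \<le> r * q x"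
    proof (cases "r = 0")
      case True
      then show ?thesis using q_le[of 0 0] by (simp add: F_def sublinear_zero[OF p])
    next
      case False
      have "inverse r * q (r *\<^sub>R x) \<le> q x"
      proof (rule q_ge)
        fix t :: real assume "0 \<le> t"
        then have "q (r *\<^sub>R x) \<le> r * F x t"
          using q_le[of "r * t" "r *\<^sub>R x"] F_scale[OF r, of x t] r by simp
        then show "inverse r * q (r *\<^sub>R x) \<le> F x t"
          using r False by (simp add: field_simps)
      qed
      then show ?thesis using r False by (simp add: field_simps)
    qed
  qed
  moreover have "q \<le> p"
    using q_le[of 0] by (simp add: F_def le_fun_def)
  moreover have "q x \<le> p (x + y) - p y" for x
    using q_le[of 1 x] by (simp add: F_def)
  ultimately show thesis by (rule that)
qed

text \<open>The minimal sublinear functionals are the linear ones, so Zorn's lemma is applied to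
  sublinear functionals on the whole space and no partially defined functionals occur.\<close>

lemma minimal_sublinear_exists:
  assumes p: "sublinear p"
  obtains q where "sublinear q" "q \<le> p" "\<And>q'. sublinear q' \<Longrightarrow> q' \<le> q \<Longrightarrow> q' = q"
proof -
  define A where "A = {q. sublinear q \<and> q \<le> p}"
  have "\<exists>m\<in>A. \<forall>a\<in>A. m \<ge> a \<longrightarrow> a = m"
  proof (rule predicate_Zorn)
    show "partial_order_on A (relation_of (\<lambda>x y. x \<ge> y) A)"
      by (auto simp: partial_order_on_def preorder_on_def refl_on_def trans_def antisym_def
          relation_of_def)
  next
    fix C assume C: "C \<in> Chains (relation_of (\<lambda>x y. x \<ge> y) A)"
    then have CA: "C \<subseteq> A" and chain: "\<And>q r. q \<in> C \<Longrightarrow> r \<in> C \<Longrightarrow> q \<ge> r \<or> r \<ge> q"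
      by (auto simp: Chains_def relation_of_def)
    show "\<exists>u\<in>A. \<forall>a\<in>C. a \<ge> u"
    proof (cases "C = {}")
      case True
      then show ?thesis using p by (auto simp: A_def)
    next
      case False
      define u where "u x = (INF q\<in>C. q x)" for x
      have lower: "- p (- x) \<le> q x" if "q \<in> C" for q x
      proof -
        have "q (- x) \<le> p (- x)" "sublinear q"
          using that CA by (auto simp: A_def le_fun_def)
        then show ?thesis using sublinear_ge[of q x] by linarith
      qed
      have u_le: "u x \<le> q x" if "q \<in> C" for q x
        unfolding u_def using lower that by (intro cINF_lower bdd_belowI2[of _ "- p (- x)"]) auto
      have u_ge: "c \<le> u x" if "\<And>q. q \<in> C \<Longrightarrow> c \<le> q x" for c x
        unfolding u_def using that False by (intro cINF_greatest) auto
      have sub: "sublinear q" if "q \<in> C" for q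
        using that CA by (auto simp: A_def)
      have "sublinear u"
        unfolding sublinear_def
      proof (intro conjI allI impI)
        fix x y
        have "u (x + y) \<le> q x + r y" if qr: "q \<in> C" "r \<in> C" for q r
        proof -
          \<comment> \<open>The smaller of the two chain members serves as \<open>s\<close>; its
            subadditivity then bounds the mixed sum.\<close>
          obtain s where s: "s \<in> C" "s \<le> q" "s \<le> r"
            using chain[OF qr] qr by blast
          have "u (x + y) \<le> s x + s y"
            using u_le[OF s(1)] sublinear_add[OF sub[OF s(1)]] by (meson order_trans)
          also have "\<dots> \<le> q x + r y"
            using s by (intro add_mono) (auto simp: le_fun_def)
          finally show ?thesis .
        qed
        then have "u (x + y) - q x \<le> r y" if "q \<in> C" "r \<in> C" for q r
          using that by (fastforce simp: algebra_simps)
        then have "u (x + y) - q x \<le> u y" if "q \<in> C" for q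
          using that by (intro u_ge) auto
        then have "u (x + y) - u y \<le> u x"
          by (intro u_ge) (simp add: algebra_simps)
        then show "u (x + y) \<le> u x + u y" by simp
      next
        fix r :: real and x assume r: "0 \<le> r"
        have *: "u (r *\<^sub>R x) \<le> r * q x" if "q \<in> C" for q
          using u_le[OF that] sublinear_scaleR_le[OF sub[OF that] r] by (meson order_trans)
        show "u (r *\<^sub>R x) \<le> r * u x"
        proof (cases "r = 0")
          case True
          then show ?thesis using * False by auto
        next
          case False
          have "inverse r * u (r *\<^sub>R x) \<le> u x"
            using * r False by (intro u_ge) (simp add: field_simps)
          then show ?thesis using r False by (simp add: field_simps)
        qed
      qed
      moreover have "u \<le> p"
      proof (rule le_funI)
        fix x
        obtain q where q: "q \<in> C" using False by blast
        then have "q \<le> p" using CA by (auto simp: A_def)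
        then have "q x \<le> p x" by (rule le_funD)
        with u_le[OF q] show "u x \<le> p x" by (rule order_trans)
      qed
      ultimately show ?thesis
        using u_le by (auto simp: A_def le_fun_def)
    qed
  qed
  then obtain m where m: "m \<in> A" "\<And>a. a \<in> A \<Longrightarrow> a \<le> m \<Longrightarrow> a = m" by blast
  show thesis
  proof (rule that[of m])
    show "sublinear m" "m \<le> p" using m by (auto simp: A_def)
    then show "q' = m" if "sublinear q'" "q' \<le> m" for q'
      using that by (intro m) (auto simp: A_def intro: order_trans)
  qed
qed

text \<open>Shrinking \<open>p\<close> along \<open>y\<close> first gives
  \<open>p' (- y) \<le> - p y\<close>, so any linear functional below \<open>p'\<close> takes the
  value \<open>p y\<close> at \<open>y\<close>. A minimal sublinear functional below
  \<open>p'\<close> is linear because shrinking it in any direction returns it unchanged.\<close>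

lemma Hahn_Banach_sublinear:
  assumes p: "sublinear p"
  obtains f where "linear f" "f \<le> p" "f y = p y"
proof -
  obtain p' where p': "sublinear p'" "p' \<le> p" "\<And>x. p' x \<le> p (x + y) - p y"
    using sublinear_shrink[OF p] by blast
  obtain f where f: "sublinear f" "f \<le> p'"
      and fmin: "\<And>q. sublinear q \<Longrightarrow> q \<le> f \<Longrightarrow> q = f"
    using minimal_sublinear_exists[OF p'(1)] by blast
  have add: "f (x + z) = f x + f z" for x z
  proof -
    obtain q where q: "sublinear q" "q \<le> f" "\<And>x. q x \<le> f (x + z) - f z"
      using sublinear_shrink[OF f(1)] by blast
    from fmin[OF q(1,2)] q(3)[of x] sublinear_add[OF f(1), of x z] show ?thesis by simp
  qed
  have neg: "f (- x) = - f x" for x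
    using add[of x "- x"] sublinear_zero[OF f(1)] by simp
  have "f (r *\<^sub>R x) = r *\<^sub>R f x" for r x
  proof (cases "0 \<le> r")
    case False
    then show ?thesis
      using sublinear_scaleR[OF f(1), of "- r" x] neg[of "r *\<^sub>R x"] by simp
  qed (simp add: sublinear_scaleR[OF f(1)])
  with add have "linear f" by (intro linearI)
  moreover have fp: "f \<le> p" using f(2) p'(2) by simp
  moreover have "f y = p y"
  proof (rule antisym)
    have "- f y \<le> - p y"
      using le_funD[OF f(2), of "- y"] p'(3)[of "- y"] sublinear_zero[OF p] neg[of y] by simp
    then show "p y \<le> f y" by simp
    show "f y \<le> p y" using fp by (rule le_funD)
  qed
  ultimately show thesis by (rule that)
qed

text \<open>Sums and multiples of approximating points stay in \<open>J\<close>, so the estimates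
  for \<open>dist\<close> pass to the infimum.\<close>

lemma sublinear_infdist:
  fixes J :: "'a::real_normed_vector set"
  assumes J: "subspace J"
  shows "sublinear (\<lambda>x. infdist x J)"
  unfolding sublinear_def
proof (intro conjI allI impI)
  have ne: "J \<noteq> {}" using subspace_0[OF J] by blast
  have approx: "c \<le> infdist x J" if "\<And>a. a \<in> J \<Longrightarrow> c \<le> dist x a" for c x
    unfolding infdist_notempty[OF ne] using that ne by (intro cINF_greatest) auto
  {
    fix x y
    have *: "infdist (x + y) J \<le> dist x a + dist y b" if "a \<in> J" "b \<in> J" for a b
      using infdist_le[OF subspace_add[OF J that], of "x + y"] dist_triangle_add[of x y a b]
      by linarith
    then have "infdist (x + y) J - dist x a \<le> infdist y J" if "a \<in> J" for a
      using that by (intro approx) (simp add: algebra_simps)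
    then have "infdist (x + y) J - infdist y J \<le> infdist x J"
      by (intro approx) (simp add: algebra_simps)
    then show "infdist (x + y) J \<le> infdist x J + infdist y J" by simp
  next
    fix r :: real and x assume r: "0 \<le> r"
    have *: "infdist (r *\<^sub>R x) J \<le> r * dist x a" if "a \<in> J" for a
      using infdist_le[OF subspace_scale[OF J that, of r], of "r *\<^sub>R x"] r
      by (simp add: dist_norm flip: scaleR_diff_right)
    show "infdist (r *\<^sub>R x) J \<le> r * infdist x J"
    proof (cases "r = 0")
      case True
      then show ?thesis using subspace_0[OF J] by simp
    next
      case False
      have "inverse r * infdist (r *\<^sub>R x) J \<le> infdist x J"
        using * r False by (intro approx) (simp add: field_simps)
      then show ?thesis using r False by (simp add: field_simps)
    qed
  }
qed

text \<open>A linear functional dominated by the distance to \<open>J\<close> vanishes on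
  \<open>J\<close> and has norm at most 1; choosing it to attain the distance at \<open>y\<close>
  makes it nonzero there.\<close>

corollary separating_functional:
  fixes J :: "'a::real_normed_vector set"
  assumes J: "subspace J" "closed J" and y: "y \<notin> J"
  obtains f :: "'a \<Rightarrow> real" where "bounded_linear f" "\<And>x. x \<in> J \<Longrightarrow> f x = 0" "f y \<noteq> 0"
proof -
  obtain f where f: "linear f" "f \<le> (\<lambda>x. infdist x J)" "f y = infdist y J"
    using Hahn_Banach_sublinear[OF sublinear_infdist[OF J(1)]] by metis
  have upper: "f x \<le> infdist x J" for x
    using f(2) by (rule le_funD)
  have le: "f x \<le> norm x" for x
    using upper[of x] infdist_le[OF subspace_0[OF J(1)], of x] by simp
  have bounded: "\<bar>f x\<bar> \<le> norm x" for x
    using le[of x] le[of "- x"] linear_neg[OF f(1), of x] by simp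
  have "bounded_linear f"
    using f(1) bounded by (intro bounded_linear_intro[of _ 1]) (auto simp: linear_add linear_scale)
  moreover have "f x = 0" if "x \<in> J" for x
    using upper[of x] upper[of "- x"] that subspace_neg[OF J(1) that] linear_neg[OF f(1), of x]
    by simp
  moreover have "f y \<noteq> 0"
    using f(3) in_closed_iff_infdist_zero[OF J(2), of y] y subspace_0[OF J(1)] by auto
  ultimately show thesis by (rule that)
qed

section \<open>Complex Banach lattices\<close>

lemma scaleC_one: "1 *\<^sub>C x = (x::'a::complex_normed_vector)"
  using scaleC_of_real[of 1 x] by simp

lemma scaleC_minus_one: "(- 1) *\<^sub>C x = - (x::'a::complex_normed_vector)"
  using scaleC_of_real[of "- 1" x] by simp

lemma bounded_linear_scaleC: "bounded_linear (\<lambda>x::'a::complex_normed_vector. c *\<^sub>C x)"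
proof (rule bounded_linear_intro[of _ "cmod c"])
  show "c *\<^sub>C r *\<^sub>R x = r *\<^sub>R c *\<^sub>C x" for r and x :: 'a
    by (simp add: scaleC_scaleC mult.commute flip: scaleC_of_real)
qed (simp_all add: scaleC_add_right norm_scaleC mult.commute)

lemmas scaleC_scaleR = linear_scale[OF bounded_linear.linear[OF bounded_linear_scaleC]]

lemma scaleC_zero: "c *\<^sub>C 0 = (0::'a::complex_normed_vector)"
  by (rule linear_0[OF bounded_linear.linear[OF bounded_linear_scaleC]])

lemma complex_linearD: "complex_linear T \<Longrightarrow> T (c *\<^sub>C x) = c *\<^sub>C T x"
  by (simp add: complex_linear_def)

section \<open>Conjugation and real parts\<close>

lemma linear_vcnj: "linear (vcnj :: 'a::complex_banach_lattice \<Rightarrow> 'a)"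
proof (rule linearI)
  show "vcnj (r *\<^sub>R x) = r *\<^sub>R vcnj x" for r and x :: 'a
    using vcnj_scaleC[of "of_real r" x] by (simp add: scaleC_of_real)
qed (rule vcnj_add)

definition real_part :: "'a::complex_banach_lattice \<Rightarrow> 'a" where
  "real_part z = (1/2) *\<^sub>R (z + vcnj z)"

lemma linear_real_part: "linear (real_part :: 'a::complex_banach_lattice \<Rightarrow> 'a)"
  by (rule linearI)
    (simp_all add: real_part_def linear_add[OF linear_vcnj] linear_scale[OF linear_vcnj]
      scaleR_right_distrib)

lemma vcnj_real_part: "vcnj (real_part z) = real_part z"
  by (simp add: real_part_def linear_add[OF linear_vcnj] linear_scale[OF linear_vcnj] vcnj_vcnj
      add.commute)

lemma real_part_real: "vcnj x = x \<Longrightarrow> real_part x = x"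
  by (simp add: real_part_def scaleR_2[symmetric])

lemma real_part_scaleC_real:
  assumes "vcnj x = x"
  shows "real_part (c *\<^sub>C x) = Re c *\<^sub>R x"
proof -
  have "real_part (c *\<^sub>C x) = (1/2) *\<^sub>R (c + cnj c) *\<^sub>C x"
    by (simp add: real_part_def vcnj_scaleC assms scaleC_add_left)
  also have "\<dots> = Re c *\<^sub>R x"
    by (simp only: complex_add_cnj scaleC_of_real) simp
  finally show ?thesis .
qed

lemma real_part_vcnj: "real_part (vcnj z) = real_part z"
  by (simp add: real_part_def vcnj_vcnj add.commute)

text \<open>The imaginary part of \<open>z\<close> is the real part of -i z.\<close>

lemma complex_decomposition:
  "z = real_part z + \<i> *\<^sub>C real_part ((- \<i>) *\<^sub>C z)"
proof -
  have "\<i> *\<^sub>C real_part ((- \<i>) *\<^sub>C z) = (1/2) *\<^sub>R (z - vcnj z)"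
    by (simp add: real_part_def vcnj_scaleC scaleC_scaleR scaleC_add_right scaleC_scaleC
        scaleC_one scaleC_minus_one)
  then show ?thesis
    by (simp add: real_part_def flip: scaleR_add_right scaleR_2)
qed

section \<open>The modulus\<close>

lemma real_part_scaleC_le_modulus: "cmod c = 1 \<Longrightarrow> real_part (c *\<^sub>C z) \<le> modulus z"
  unfolding real_part_def by (rule modulus_upper)

lemma modulus_leI: "(\<And>c. cmod c = 1 \<Longrightarrow> real_part (c *\<^sub>C z) \<le> u) \<Longrightarrow> modulus z \<le> u"
  unfolding real_part_def by (rule modulus_least)

lemma real_part_le_modulus: "real_part z \<le> modulus z"
  using real_part_scaleC_le_modulus[of 1 z] by (simp add: scaleC_one)

lemma minus_real_part_le_modulus: "- real_part z \<le> modulus z"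
  using real_part_scaleC_le_modulus[of "-1" z]
  by (simp add: scaleC_minus_one linear_neg[OF linear_real_part])

lemma real_le_modulus: "vcnj x = x \<Longrightarrow> x \<le> modulus x"
  using real_part_le_modulus[of x] by (simp add: real_part_real)

lemma modulus_nonneg: "0 \<le> modulus (z::'a::complex_banach_lattice)"
proof -
  have "0 \<le> 2 *\<^sub>R modulus z"
    using add_mono[OF real_part_le_modulus minus_real_part_le_modulus, of z z]
    by (simp add: scaleR_2)
  from scaleR_left_mono[OF this, of "1/2"] show ?thesis by simp
qed

lemma modulus_of_nonneg:
  assumes "0 \<le> (x::'a::complex_banach_lattice)"
  shows "modulus x = x"
proof (rule antisym)
  show "modulus x \<le> x"
  proof (rule modulus_leI)
    fix c :: complex assume "cmod c = 1"
    then have "Re c *\<^sub>R x \<le> 1 *\<^sub>R x"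
      using complex_Re_le_cmod[of c] assms by (intro scaleR_right_mono) auto
    then show "real_part (c *\<^sub>C x) \<le> x"
      by (simp add: real_part_scaleC_real vcnj_nonneg assms)
  qed
qed (simp add: real_le_modulus vcnj_nonneg assms)

lemma modulus_triangle: "modulus (x + y) \<le> modulus x + modulus y"
  by (rule modulus_leI)
    (auto simp: scaleC_add_right linear_add[OF linear_real_part]
      intro!: add_mono real_part_scaleC_le_modulus)

lemma modulus_scaleC_le: "modulus (c *\<^sub>C z) \<le> cmod c *\<^sub>R modulus z"
proof (rule modulus_leI)
  fix d :: complex assume d: "cmod d = 1"
  show "real_part (d *\<^sub>C c *\<^sub>C z) \<le> cmod c *\<^sub>R modulus z"
  proof (cases "c = 0")
    case True
    then have "c *\<^sub>C z = 0" using scaleC_of_real[of 0 z] by simp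
    then show ?thesis
      using True by (simp add: scaleC_zero linear_0[OF linear_real_part])
  next
    case False
    \<comment> \<open>Polar decomposition of \<open>c\<close>: the factor \<open>d * sgn c\<close>
      is unimodular, so it is one of the rotations bounded by the modulus.\<close>
    have "d * c = of_real (cmod c) * (d * sgn c)"
      using False by (simp add: sgn_div_norm scaleR_conv_of_real)
    then have "d *\<^sub>C c *\<^sub>C z = cmod c *\<^sub>R (d * sgn c) *\<^sub>C z"
      by (simp only: scaleC_scaleC flip: scaleC_of_real)
    then have "real_part (d *\<^sub>C c *\<^sub>C z) = cmod c *\<^sub>R real_part ((d * sgn c) *\<^sub>C z)"
      by (simp add: linear_scale[OF linear_real_part])
    also have "\<dots> \<le> cmod c *\<^sub>R modulus z"
      using d False
      by (intro scaleR_left_mono real_part_scaleC_le_modulus) (auto simp: norm_mult norm_sgn)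
    finally show ?thesis .
  qed
qed

text \<open>Rotating the conjugate by \<open>c\<close> has the same real part as rotating
  \<open>z\<close> by \<open>cnj c\<close>. This is what makes conjugation continuous.\<close>

lemma modulus_vcnj_le: "modulus (vcnj z) \<le> modulus z"
proof (rule modulus_leI)
  fix c :: complex assume "cmod c = 1"
  moreover have "real_part (c *\<^sub>C vcnj z) = real_part (cnj c *\<^sub>C z)"
    using real_part_vcnj[of "cnj c *\<^sub>C z"] by (simp add: vcnj_scaleC)
  ultimately show "real_part (c *\<^sub>C vcnj z) \<le> modulus z"
    by (simp add: real_part_scaleC_le_modulus)
qed

lemma bounded_linear_vcnj: "bounded_linear (vcnj :: 'a::complex_banach_lattice \<Rightarrow> 'a)"
proof (rule bounded_linear_intro[of _ 1])
  show "norm (vcnj x) \<le> norm x * 1" for x :: 'a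
    using norm_mono_nonneg[OF modulus_nonneg modulus_vcnj_le, of x] by (simp add: norm_modulus)
qed (simp_all add: linear_add[OF linear_vcnj] linear_scale[OF linear_vcnj])

lemma nonneg_real_minus: "0 \<le> x \<Longrightarrow> 0 \<le> y \<Longrightarrow> vcnj (x - y) = x - y"
  by (simp add: linear_diff[OF linear_vcnj] vcnj_nonneg)

section \<open>Positive parts, closedness of the cone and Riesz decomposition\<close>

lemma positive_part_exists:
  assumes "vcnj x = x"
  obtains p where "0 \<le> p" "x \<le> p" "\<And>u. 0 \<le> u \<Longrightarrow> x \<le> u \<Longrightarrow> p \<le> u"
  using real_sup_exists[OF assms linear_0[OF linear_vcnj]] by metis

text \<open>The limit \<open>x\<close> is real by continuity of conjugation, so it has a negative
  part \<open>p\<close>. Since - x \<le> \<open>X n - x\<close>, this part lies below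
  \<open>modulus (X n - x)\<close>, whose norm tends to 0; hence \<open>p\<close> = 0.\<close>

lemma closed_positive_cone: "closed {x::'a::complex_banach_lattice. 0 \<le> x}"
  unfolding closed_sequential_limits
proof (intro allI impI, elim conjE)
  fix X :: "nat \<Rightarrow> 'a" and x
  assume X: "\<forall>n. X n \<in> {x. 0 \<le> x}" and lim: "X \<longlonglongrightarrow> x"
  have "(\<lambda>n. vcnj (X n)) \<longlonglongrightarrow> vcnj x"
    by (rule bounded_linear.tendsto[OF bounded_linear_vcnj lim])
  moreover have "(\<lambda>n. vcnj (X n)) = X"
    using X by (auto simp: vcnj_nonneg)
  ultimately have "X \<longlonglongrightarrow> vcnj x" by simp
  then have real: "vcnj x = x" using lim by (rule LIMSEQ_unique)
  then have "vcnj (- x) = - x"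
    by (simp add: linear_neg[OF linear_vcnj])
  then obtain p where p: "0 \<le> p" "- x \<le> p" "\<And>u. 0 \<le> u \<Longrightarrow> - x \<le> u \<Longrightarrow> p \<le> u"
    by (rule positive_part_exists) blast
  have "norm p \<le> norm (X n - x)" for n
  proof -
    have "X n - x \<le> modulus (X n - x)"
      using X real by (intro real_le_modulus) (simp add: linear_diff[OF linear_vcnj] vcnj_nonneg)
    moreover have "- x \<le> X n - x"
      using X by (simp add: algebra_simps)
    ultimately have "p \<le> modulus (X n - x)"
      by (intro p(3) modulus_nonneg) (rule order_trans)
    from norm_mono_nonneg[OF p(1) this] show ?thesis by (simp add: norm_modulus)
  qed
  moreover have "(\<lambda>n. norm (X n - x)) \<longlonglongrightarrow> 0"
    using lim by (simp add: LIM_zero tendsto_norm_zero)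
  ultimately have "norm p \<le> 0"
    by (intro LIMSEQ_le_const) auto
  then show "x \<in> {x. 0 \<le> x}" using p(2) by simp
qed

lemma tendsto_nonneg:
  "(X :: nat \<Rightarrow> 'a::complex_banach_lattice) \<longlonglongrightarrow> x \<Longrightarrow> (\<And>n. 0 \<le> X n) \<Longrightarrow> 0 \<le> x"
  using closed_positive_cone unfolding closed_sequential_limits by blast

lemma suminf_nonneg_vec:
  fixes X :: "nat \<Rightarrow> 'a::complex_banach_lattice"
  assumes "summable X" "\<And>n. 0 \<le> X n"
  shows "X m \<le> suminf X" "0 \<le> suminf X"
proof -
  show "0 \<le> suminf X"
    by (rule tendsto_nonneg[OF summable_LIMSEQ[OF assms(1)]]) (simp add: sum_nonneg assms)
  \<comment> \<open>The shift by \<open>Suc m\<close> ensures that every partial sum contains the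
    term \<open>X m\<close>.\<close>
  have "(\<lambda>n. (\<Sum>i<n + Suc m. X i) - X m) \<longlonglongrightarrow> suminf X - X m"
    by (intro tendsto_diff tendsto_const LIMSEQ_ignore_initial_segment summable_LIMSEQ assms)
  then have "0 \<le> suminf X - X m"
  proof (rule tendsto_nonneg)
    show "0 \<le> (\<Sum>i<n + Suc m. X i) - X m" for n
      using assms(2) sum_nonneg[of "{..<n + Suc m} - {m}" X] by (simp add: sum_diff1)
  qed
  then show "X m \<le> suminf X" by simp
qed

lemma Riesz_decomposition:
  fixes x a e :: "'a::complex_banach_lattice"
  assumes "0 \<le> x" "0 \<le> a" "0 \<le> e" "x \<le> a + e"
  obtains y where "0 \<le> y" "y \<le> a" "0 \<le> x - y" "x - y \<le> e"
proof -
  obtain p where p: "0 \<le> p" "x - a \<le> p" "\<And>u. 0 \<le> u \<Longrightarrow> x - a \<le> u \<Longrightarrow> p \<le> u"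
    using positive_part_exists[OF nonneg_real_minus[OF assms(1,2)]] by blast
  have "p \<le> x" "p \<le> e"
    using assms by (auto intro!: p(3) simp: algebra_simps)
  with p show thesis
    by (intro that[of "x - p"]) (auto simp: algebra_simps)
qed

section \<open>Positive operators and the modulus\<close>

context
  fixes T :: "'a::complex_banach_lattice \<Rightarrow>\<^sub>L 'a"
  assumes T: "positive_operator T" "complex_linear T"
begin

lemma positive_operator_mono: "x \<le> y \<Longrightarrow> T x \<le> T y"
  using T(1) by (auto simp: positive_operator_def blinfun.diff_right dest!: spec[of _ "y - x"])

text \<open>A real \<open>x\<close> is the difference of the positive vectors
  \<open>modulus x\<close> and \<open>modulus x - x\<close>, so \<open>T x\<close> is real. Complex
  linearity then carries \<open>T\<close> through the decomposition of \<open>z\<close>.\<close>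

lemma positive_operator_real_part: "T (real_part z) = real_part (T z)"
proof -
  have real: "vcnj (T x) = T x" if "vcnj x = x" for x
  proof -
    have "0 \<le> modulus x - x"
      using real_le_modulus[OF that] by simp
    then have "vcnj (T (modulus x) - T (modulus x - x)) = T (modulus x) - T (modulus x - x)"
      using T(1) modulus_nonneg by (intro nonneg_real_minus) (auto simp: positive_operator_def)
    then show ?thesis by (simp flip: blinfun.diff_right)
  qed
  let ?a = "real_part z" and ?b = "real_part ((- \<i>) *\<^sub>C z)"
  have "T z = T ?a + \<i> *\<^sub>C T ?b"
    by (subst complex_decomposition[of z]) (simp only: blinfun.add_right complex_linearD[OF T(2)])
  then have "real_part (T z) = T ?a"
    by (simp add: linear_add[OF linear_real_part] real_part_scaleC_real real real_part_real
        vcnj_real_part)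
  then show ?thesis ..
qed

text \<open>Applying \<open>T\<close> to \<open>real_part (c *\<^sub>C z) \<le> modulus z\<close>
  bounds every rotated real part of \<open>T z\<close>, and the modulus is the least such
  bound.\<close>

lemma positive_operator_modulus: "modulus (T z) \<le> T (modulus z)"
proof (rule modulus_leI)
  fix c :: complex assume "cmod c = 1"
  then have "T (real_part (c *\<^sub>C z)) \<le> T (modulus z)"
    by (intro positive_operator_mono real_part_scaleC_le_modulus)
  then show "real_part (c *\<^sub>C T z) \<le> T (modulus z)"
    by (simp add: positive_operator_real_part complex_linearD[OF T(2)])
qed

end

section \<open>Closed principal ideals\<close>

text \<open>This is the closure of the principal ideal of \<open>u\<close>; describing it by order bounds up to a
  small error makes it evident that it is solid, without continuity of the modulus or
  a decomposition property in the complexification.\<close>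

definition closed_principal_ideal :: "'a::complex_banach_lattice \<Rightarrow> 'a set" where
  "closed_principal_ideal u =
     {x. \<forall>\<epsilon>>0. \<exists>c\<ge>0. \<exists>e\<ge>0. norm e \<le> \<epsilon> \<and> modulus x \<le> c *\<^sub>R u + e}"

lemma closed_principal_idealE:
  assumes "x \<in> closed_principal_ideal u" "\<epsilon> > 0"
  obtains c e where "0 \<le> c" "0 \<le> e" "norm e \<le> \<epsilon>" "modulus x \<le> c *\<^sub>R u + e"
  using assms unfolding closed_principal_ideal_def by blast

lemma closed_principal_idealI:
  assumes "\<And>\<epsilon>. \<epsilon> > 0 \<Longrightarrow> \<exists>c\<ge>0. \<exists>e\<ge>0. norm e \<le> \<epsilon> \<and> modulus x \<le> c *\<^sub>R u + e"
  shows "x \<in> closed_principal_ideal u"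
  using assms unfolding closed_principal_ideal_def by blast

lemma closed_principal_ideal_solid:
  "x \<in> closed_principal_ideal u \<Longrightarrow> modulus y \<le> modulus x \<Longrightarrow> y \<in> closed_principal_ideal u"
  by (rule closed_principal_idealI) (meson closed_principal_idealE order_trans)

lemma le_in_closed_principal_ideal:
  assumes "0 \<le> x" "x \<le> u"
  shows "x \<in> closed_principal_ideal u"
  using assms by (intro closed_principal_idealI exI[of _ "1::real"] exI[of _ "0::'a"])
    (auto simp: modulus_of_nonneg)

lemma closed_principal_ideal_scaleC:
  assumes "x \<in> closed_principal_ideal u"
  shows "a *\<^sub>C x \<in> closed_principal_ideal u"
proof (rule closed_principal_idealI)
  fix \<epsilon> :: real assume \<epsilon>: "\<epsilon> > 0"
  \<comment> \<open>The summand 1 keeps \<open>k\<close> positive, so that \<epsilon> can be divided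
    by it even when \<open>a\<close> = 0.\<close>
  define k where "k = cmod a + 1"
  have k: "k > 0" "cmod a \<le> k" by (auto simp: k_def add_nonneg_pos)
  obtain c e where ce: "0 \<le> c" "0 \<le> e" "norm e \<le> \<epsilon> / k" "modulus x \<le> c *\<^sub>R u + e"
    using closed_principal_idealE[OF assms, of "\<epsilon> / k"] \<epsilon> k by auto
  have "modulus (a *\<^sub>C x) \<le> k *\<^sub>R modulus x"
    using modulus_scaleC_le[of a x] scaleR_right_mono[OF k(2) modulus_nonneg, of x] by simp
  also have "\<dots> \<le> k *\<^sub>R (c *\<^sub>R u + e)"
    using k ce by (intro scaleR_left_mono) auto
  finally have "modulus (a *\<^sub>C x) \<le> (k * c) *\<^sub>R u + k *\<^sub>R e"
    by (simp add: scaleR_right_distrib)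
  moreover have "norm (k *\<^sub>R e) \<le> \<epsilon>" "0 \<le> k *\<^sub>R e" "0 \<le> k * c"
    using k ce by (auto simp: field_simps scaleR_nonneg_nonneg)
  ultimately show "\<exists>c\<ge>0. \<exists>e\<ge>0. norm e \<le> \<epsilon> \<and> modulus (a *\<^sub>C x) \<le> c *\<^sub>R u + e" by blast
qed

lemma closed_principal_ideal_add:
  assumes "x \<in> closed_principal_ideal u" "y \<in> closed_principal_ideal u"
  shows "x + y \<in> closed_principal_ideal u"
proof (rule closed_principal_idealI)
  fix \<epsilon> :: real assume "\<epsilon> > 0"
  then have "\<epsilon> / 2 > 0" by simp
  obtain c e where ce: "0 \<le> c" "0 \<le> e" "norm e \<le> \<epsilon> / 2" "modulus x \<le> c *\<^sub>R u + e"
    by (rule closed_principal_idealE[OF assms(1) \<open>\<epsilon> / 2 > 0\<close>])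
  obtain d f where df: "0 \<le> d" "0 \<le> f" "norm f \<le> \<epsilon> / 2" "modulus y \<le> d *\<^sub>R u + f"
    by (rule closed_principal_idealE[OF assms(2) \<open>\<epsilon> / 2 > 0\<close>])
  have "modulus (x + y) \<le> (c *\<^sub>R u + e) + (d *\<^sub>R u + f)"
    using modulus_triangle add_mono[OF ce(4) df(4)] by (rule order_trans)
  then have "modulus (x + y) \<le> (c + d) *\<^sub>R u + (e + f)"
    by (simp add: scaleR_left_distrib algebra_simps)
  moreover have "norm (e + f) \<le> \<epsilon>"
    using ce df norm_triangle_ineq[of e f] by simp
  ultimately show "\<exists>c\<ge>0. \<exists>e\<ge>0. norm e \<le> \<epsilon> \<and> modulus (x + y) \<le> c *\<^sub>R u + e"
    using ce df by (intro exI[of _ "c + d"] exI[of _ "e + f"] conjI) auto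
qed

lemma closed_closed_principal_ideal: "closed (closed_principal_ideal u)"
  unfolding closed_sequential_limits
proof (intro allI impI, elim conjE)
  fix X :: "nat \<Rightarrow> 'a" and x
  assume X: "\<forall>n. X n \<in> closed_principal_ideal u" and lim: "X \<longlonglongrightarrow> x"
  show "x \<in> closed_principal_ideal u"
  proof (rule closed_principal_idealI)
    fix \<epsilon> :: real assume "\<epsilon> > 0"
    then have \<epsilon>: "\<epsilon> / 2 > 0" by simp
    obtain n where n: "norm (x - X n) < \<epsilon> / 2"
      using LIMSEQ_D[OF lim \<epsilon>] by (auto simp: norm_minus_commute)
    obtain c e where ce: "0 \<le> c" "0 \<le> e" "norm e \<le> \<epsilon> / 2" "modulus (X n) \<le> c *\<^sub>R u + e"
      using closed_principal_idealE[OF X[rule_format] \<epsilon>] by blast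
    \<comment> \<open>The distance from \<open>x\<close> to \<open>X n\<close> enters through
      \<open>modulus (x - X n)\<close>, which is absorbed into the error term.\<close>
    have "modulus x \<le> modulus (X n) + modulus (x - X n)"
      using modulus_triangle[of "X n" "x - X n"] by simp
    also have "\<dots> \<le> (c *\<^sub>R u + e) + modulus (x - X n)"
      using ce by simp
    finally have "modulus x \<le> c *\<^sub>R u + (e + modulus (x - X n))"
      by (simp add: algebra_simps)
    moreover have "norm (e + modulus (x - X n)) \<le> \<epsilon>"
      using ce n norm_triangle_ineq[of e "modulus (x - X n)"] by (simp add: norm_modulus)
    ultimately show "\<exists>c\<ge>0. \<exists>e\<ge>0. norm e \<le> \<epsilon> \<and> modulus x \<le> c *\<^sub>R u + e"
      using ce modulus_nonneg[of "x - X n"]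
      by (intro exI[of _ c] exI[of _ "e + modulus (x - X n)"] conjI) auto
  qed
qed

lemma lattice_ideal_closed_principal_ideal:
  assumes "0 \<le> u"
  shows "lattice_ideal (closed_principal_ideal u)"
  unfolding lattice_ideal_def
  using le_in_closed_principal_ideal[of 0 u] assms
  by (auto intro: closed_principal_ideal_add closed_principal_ideal_scaleC
      closed_principal_ideal_solid)

text \<open>A bound \<open>c *\<^sub>R u + e\<close> for \<open>modulus x\<close> is sent to
  \<open>c *\<^sub>R T u + T e\<close>, and \<open>T u\<close> is itself bounded by a multiple of
  \<open>u\<close> up to an error. Thus invariance only has to be checked at
  \<open>u\<close>.\<close>

lemma closed_principal_ideal_invariant:
  assumes T: "positive_operator T" "complex_linear T"
    and Tu: "T u \<in> closed_principal_ideal u" "0 \<le> u"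
    and x: "x \<in> closed_principal_ideal u"
  shows "T x \<in> closed_principal_ideal u"
proof (rule closed_principal_idealI)
  fix \<epsilon> :: real assume \<epsilon>: "\<epsilon> > 0"
  define k where "k = norm T + 1"
  have k: "k > 0" "norm T \<le> k" by (auto simp: k_def add_nonneg_pos)
  obtain c e where ce: "0 \<le> c" "0 \<le> e" "norm e \<le> \<epsilon> / 2 / k" "modulus x \<le> c *\<^sub>R u + e"
    using closed_principal_idealE[OF x, of "\<epsilon> / 2 / k"] \<epsilon> k by auto
  \<comment> \<open>The constant \<open>c\<close> is already fixed and will multiply
    \<open>f\<close>, hence this tolerance; the summand 1 covers \<open>c\<close> = 0.\<close>
  obtain d f where df: "0 \<le> d" "0 \<le> f" "norm f \<le> \<epsilon> / 2 / (c + 1)"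
      "modulus (T u) \<le> d *\<^sub>R u + f"
    using closed_principal_idealE[OF Tu(1), of "\<epsilon> / 2 / (c + 1)"] \<epsilon> ce by auto
  have Tpos: "0 \<le> T y" if "0 \<le> y" for y
    using T(1) that by (simp add: positive_operator_def)
  have "modulus (T x) \<le> T (modulus x)"
    by (rule positive_operator_modulus[OF T])
  also have "\<dots> \<le> T (c *\<^sub>R u + e)"
    by (rule positive_operator_mono[OF T ce(4)])
  also have "\<dots> = c *\<^sub>R T u + T e"
    by (simp add: blinfun.add_right blinfun.scaleR_right)
  also have "\<dots> \<le> c *\<^sub>R (d *\<^sub>R u + f) + T e"
    using df(4) ce(1) modulus_of_nonneg[OF Tpos[OF Tu(2)]]
    by (intro add_right_mono scaleR_left_mono) auto
  finally have "modulus (T x) \<le> (c * d) *\<^sub>R u + (c *\<^sub>R f + T e)"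
    by (simp add: scaleR_right_distrib add.assoc)
  moreover have "norm (c *\<^sub>R f + T e) \<le> \<epsilon>"
  proof -
    have "c * norm f \<le> (c + 1) * norm f"
      by (simp add: mult_right_mono)
    also have "\<dots> \<le> \<epsilon> / 2"
      using df(3) ce(1) by (simp add: field_simps)
    finally have "norm (c *\<^sub>R f) \<le> \<epsilon> / 2" using ce by simp
    moreover have "norm (T e) \<le> k * norm e"
      using norm_blinfun[of T e] mult_right_mono[OF k(2), of "norm e"] by simp
    then have "norm (T e) \<le> \<epsilon> / 2"
      using ce(3) k(1) by (simp add: field_simps)
    ultimately show ?thesis
      using norm_triangle_ineq[of "c *\<^sub>R f" "T e"] by simp
  qed
  ultimately show "\<exists>c\<ge>0. \<exists>e\<ge>0. norm e \<le> \<epsilon> \<and> modulus (T x) \<le> c *\<^sub>R u + e"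
    using ce df Tpos[OF ce(2)]
    by (intro exI[of _ "c * d"] exI[of _ "c *\<^sub>R f + T e"] conjI)
      (auto intro: add_nonneg_nonneg scaleR_nonneg_nonneg)
qed

text \<open>Riesz decomposition turns an order bound with error into an approximating element of the
  principal ideal, for positive vectors. Real vectors are differences of positive ones, and the
  complex decomposition gives the rest.\<close>

lemma quasi_interior_if_closed_principal_ideal:
  assumes u: "0 \<le> u" and full: "closed_principal_ideal u = UNIV"
  shows "quasi_interior u"
proof -
  let ?P = "principal_ideal u"
  have P_add: "x + y \<in> ?P" if xy: "x \<in> ?P" "y \<in> ?P" for x y
  proof -
    obtain c d where cd: "c > 0" "modulus x \<le> c *\<^sub>R u" "d > 0" "modulus y \<le> d *\<^sub>R u"
      using xy by (auto simp: principal_ideal_def)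
    have "modulus (x + y) \<le> (c + d) *\<^sub>R u"
      unfolding scaleR_left_distrib
      using modulus_triangle add_mono[OF cd(2,4)] by (rule order_trans)
    moreover have "c + d > 0" using cd by simp
    ultimately show ?thesis unfolding principal_ideal_def by blast
  qed
  have P_scaleC: "a *\<^sub>C x \<in> ?P" if x: "x \<in> ?P" for a x
  proof -
    obtain c where c: "c > 0" "modulus x \<le> c *\<^sub>R u"
      using x by (auto simp: principal_ideal_def)
    have "modulus (a *\<^sub>C x) \<le> cmod a *\<^sub>R c *\<^sub>R u"
      using modulus_scaleC_le scaleR_left_mono[OF c(2)] by (rule order_trans) simp
    \<comment> \<open>The constant in \<open>principal_ideal\<close> has to be strictly positive,
      while \<open>cmod a * c\<close> may be 0.\<close>
    also have "\<dots> \<le> (cmod a * c + 1) *\<^sub>R u"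
      using scaleR_right_mono[OF _ u, of "cmod a * c" "cmod a * c + 1"] by simp
    finally have "modulus (a *\<^sub>C x) \<le> (cmod a * c + 1) *\<^sub>R u" .
    moreover have "cmod a * c + 1 > 0"
      using c(1) by (simp add: add_nonneg_pos)
    ultimately show ?thesis
      unfolding principal_ideal_def by blast
  qed
  have cl_add: "x + y \<in> closure ?P" if xy: "x \<in> closure ?P" "y \<in> closure ?P" for x y
  proof -
    obtain X Y where XY: "\<And>n. X n \<in> ?P" "X \<longlonglongrightarrow> x" "\<And>n. Y n \<in> ?P" "Y \<longlonglongrightarrow> y"
      using xy unfolding closure_sequential by blast
    show ?thesis
      unfolding closure_sequential
      by (intro exI[of _ "\<lambda>n. X n + Y n"]) (simp add: XY P_add tendsto_add)
  qed
  have cl_scaleC: "a *\<^sub>C x \<in> closure ?P" if x: "x \<in> closure ?P" for a x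
  proof -
    obtain X where X: "\<And>n. X n \<in> ?P" "X \<longlonglongrightarrow> x"
      using x unfolding closure_sequential by blast
    show ?thesis
      unfolding closure_sequential
      by (intro exI[of _ "\<lambda>n. a *\<^sub>C X n"])
        (simp add: X P_scaleC bounded_linear.tendsto[OF bounded_linear_scaleC])
  qed
  have cl_nonneg: "x \<in> closure ?P" if x: "0 \<le> x" for x
    unfolding closure_approachable
  proof (intro allI impI)
    fix \<epsilon> :: real assume \<epsilon>: "\<epsilon> > 0"
    obtain c e where ce: "0 \<le> c" "0 \<le> e" "norm e \<le> \<epsilon> / 2" "modulus x \<le> c *\<^sub>R u + e"
      using closed_principal_idealE[of x u "\<epsilon> / 2"] full \<epsilon> by auto
    obtain y where y: "0 \<le> y" "y \<le> c *\<^sub>R u" "0 \<le> x - y" "x - y \<le> e"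
      by (rule Riesz_decomposition[OF x scaleR_nonneg_nonneg[OF ce(1) u] ce(2)])
        (use ce(4) x in \<open>auto simp: modulus_of_nonneg\<close>)
    have "c *\<^sub>R u \<le> (c + 1) *\<^sub>R u"
      using u by (intro scaleR_right_mono) auto
    then have "modulus y \<le> (c + 1) *\<^sub>R u" "c + 1 > 0"
      using y ce(1) by (simp_all add: modulus_of_nonneg)
    then have "y \<in> ?P"
      unfolding principal_ideal_def by blast
    moreover have "dist y x < \<epsilon>"
      using norm_mono_nonneg[OF y(3,4)] ce(3) \<epsilon> by (simp add: dist_norm norm_minus_commute)
    ultimately show "\<exists>y\<in>?P. dist y x < \<epsilon>" by blast
  qed
  have cl_real: "x \<in> closure ?P" if "vcnj x = x" for x
  proof -
    have "modulus x + (- 1) *\<^sub>C (modulus x - x) \<in> closure ?P"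
      using cl_add[OF cl_nonneg[OF modulus_nonneg] cl_scaleC[OF cl_nonneg]] real_le_modulus[OF that]
      by simp
    then show ?thesis by (simp add: scaleC_minus_one)
  qed
  have "z \<in> closure ?P" for z
    using cl_add[OF cl_real[OF vcnj_real_part] cl_scaleC[OF cl_real[OF vcnj_real_part]]]
    by (metis complex_decomposition)
  then show ?thesis using u by (auto simp: quasi_interior_def)
qed

section \<open>Analytic semigroups\<close>

text \<open>This common notion lets the identity theorem be applied both to lattice ideals and to
  \<open>{0}\<close>.\<close>

definition complex_subspace :: "'a::complex_normed_vector set \<Rightarrow> bool" where
  "complex_subspace J \<longleftrightarrow>
     0 \<in> J \<and> (\<forall>x\<in>J. \<forall>y\<in>J. x + y \<in> J) \<and> (\<forall>c. \<forall>x\<in>J. c *\<^sub>C x \<in> J)"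

lemma complex_subspace_zero: "complex_subspace {0}"
  by (simp add: complex_subspace_def scaleC_zero)

lemma complex_subspace_lattice_ideal: "lattice_ideal J \<Longrightarrow> complex_subspace J"
  by (simp add: lattice_ideal_def complex_subspace_def)

text \<open>The real functional \<open>g\<close> is complexified as g(x) - i g(i x). Its real part
  is \<open>g\<close>, and it vanishes on \<open>J\<close> because \<open>J\<close> is stable under
  multiplication by i.\<close>

lemma complex_separating_functional:
  fixes J :: "'a::complex_normed_vector set"
  assumes J: "complex_subspace J" "closed J" and y: "y \<notin> J"
  obtains f :: "'a \<Rightarrow> complex"
  where "bounded_linear f" "\<And>c x. f (c *\<^sub>C x) = c * f x" "\<And>x. x \<in> J \<Longrightarrow> f x = 0" "f y \<noteq> 0"
proof -
  have "subspace J"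
    using J(1) by (auto simp: subspace_def complex_subspace_def simp flip: scaleC_of_real)
  then obtain g :: "'a \<Rightarrow> real"
    where g: "bounded_linear g" "\<And>x. x \<in> J \<Longrightarrow> g x = 0" "g y \<noteq> 0"
    using separating_functional[OF _ J(2) y] by metis
  note lin = bounded_linear.linear[OF g(1)]
  define f where "f x = complex_of_real (g x) - \<i> * complex_of_real (g (\<i> *\<^sub>C x))" for x
  have "f (c *\<^sub>C x) = c * f x" for c x
  proof -
    have c: "c *\<^sub>C x = Re c *\<^sub>R x + Im c *\<^sub>R \<i> *\<^sub>C x"
    proof -
      have "c = complex_of_real (Re c) + complex_of_real (Im c) * \<i>"
        by (simp add: complex_eq_iff)
      then show ?thesis
        by (metis scaleC_add_left scaleC_scaleC scaleC_of_real)
    qed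
    have ic: "\<i> *\<^sub>C c *\<^sub>C x = (- Im c) *\<^sub>R x + Re c *\<^sub>R \<i> *\<^sub>C x"
    proof -
      have "\<i> * c = complex_of_real (- Im c) + complex_of_real (Re c) * \<i>"
        by (simp add: complex_eq_iff)
      then show ?thesis
        by (metis scaleC_add_left scaleC_scaleC scaleC_of_real)
    qed
    show ?thesis
      unfolding f_def ic unfolding c
      by (simp add: linear_add[OF lin] linear_scale[OF lin] linear_diff[OF lin] complex_eq_iff)
  qed
  moreover have "bounded_linear f"
    unfolding f_def
    by (intro bounded_linear_sub bounded_linear_const_mult
        bounded_linear_compose[OF bounded_linear_of_real]
        bounded_linear_compose[OF g(1)] bounded_linear_scaleC bounded_linear_ident)
  moreover have "f x = 0" if "x \<in> J" for x
    using g(2) that J(1) by (simp add: f_def complex_subspace_def)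
  moreover have "f y \<noteq> 0"
    using g(3) by (simp add: f_def complex_eq_iff)
  ultimately show thesis by (intro that)
qed

section \<open>Orbits and the identity theorem\<close>

lemma C0_semigroup_add: "C0_semigroup T \<Longrightarrow> 0 \<le> s \<Longrightarrow> 0 \<le> t \<Longrightarrow> T (s + t) x = T s (T t x)"
  by (simp add: C0_semigroup_def)

lemma C0_semigroup_limit_mem:
  assumes "C0_semigroup T" "closed J" "\<And>t. 0 < t \<Longrightarrow> T t x \<in> J"
  shows "x \<in> J"
proof (rule Lim_in_closed_set[OF assms(2)])
  show "((\<lambda>t. T t x) \<longlongrightarrow> x) (at_right 0)"
    using assms(1) by (simp add: C0_semigroup_def)
  show "\<forall>\<^sub>F t in at_right 0. T t x \<in> J"
    using assms(3) by (simp add: eventually_at_right_less eventually_mono[OF eventually_at_right_less])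
qed simp

text \<open>The cone supplies an open connected domain containing the positive half-line; as an
  intersection of half-planes it is visibly open and convex.\<close>

lemma convex_cone_in_sector:
  assumes "0 < \<theta>" "\<theta> \<le> pi / 2"
  obtains \<Omega> where "open \<Omega>" "convex \<Omega>" "\<Omega> \<subseteq> sector \<theta>" "\<And>t. 0 < t \<Longrightarrow> complex_of_real t \<in> \<Omega>"
proof -
  \<comment> \<open>Halving the angle keeps the tangent finite when \<theta> = \<pi> / 2.\<close>
  define k where "k = tan (\<theta> / 2)"
  have k: "k > 0"
    unfolding k_def using assms by (intro tan_gt_zero) auto
  have arctan_k: "arctan k = \<theta> / 2"
    unfolding k_def using assms by (intro arctan_tan) auto
  define \<Omega> where "\<Omega> = {z. Re z > 0} \<inter> {z. Im z - k * Re z < 0} \<inter> {z. Im z + k * Re z > 0}"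
  have "open \<Omega>"
    unfolding \<Omega>_def
    by (intro open_Int open_Collect_less continuous_intros)
  moreover have "convex \<Omega>"
  proof -
    have "\<Omega> = {z. inner 1 z > 0} \<inter> {z. inner (Complex (- k) 1) z < 0} \<inter>
        {z. inner (Complex k 1) z > 0}"
      by (auto simp: \<Omega>_def inner_complex_def)
    then show ?thesis
      by (simp only:) (intro convex_Int convex_halfspace_gt convex_halfspace_lt)
  qed
  moreover have "\<Omega> \<subseteq> sector \<theta>"
  proof
    fix z assume z: "z \<in> \<Omega>"
    then have re: "Re z > 0" by (simp add: \<Omega>_def)
    have "Im z / Re z < k" "- k < Im z / Re z"
      using z re by (simp_all add: \<Omega>_def pos_divide_less_eq pos_less_divide_eq)
    then have "arctan (Im z / Re z) < arctan k" "arctan (- k) < arctan (Im z / Re z)"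
      by (simp_all only: arctan_less_iff)
    then have "\<bar>Arg z\<bar> < \<theta>"
      using assms(1) by (simp add: arg_conv_arctan[OF re] arctan_k arctan_minus)
    then show "z \<in> sector \<theta>"
      using re by (auto simp: sector_def)
  qed
  moreover have "complex_of_real t \<in> \<Omega>" if "0 < t" for t
    using that k by (simp add: \<Omega>_def)
  ultimately show thesis by (rule that)
qed

text \<open>If \<open>T r x\<close> were outside \<open>J\<close>, a complex functional vanishing on
  \<open>J\<close> but not at \<open>T r x\<close> would give a holomorphic function of
  \<open>z\<close>. It vanishes at the points \<open>\<sigma> n\<close>, which accumulate at
  \<open>s\<close> inside the cone, and is therefore zero there.\<close>

lemma analytic_semigroup_identity:
  assumes T: "analytic_C0_semigroup T"
    and J: "complex_subspace J" "closed J"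
    and s: "0 < s" "\<sigma> \<longlonglongrightarrow> s" "\<And>n. 0 < \<sigma> n" "\<And>n. \<sigma> n \<noteq> s"
    and mem: "\<And>n. T (\<sigma> n) x \<in> J"
    and t: "0 \<le> t"
  shows "T t x \<in> J"
proof -
  have C0: "C0_semigroup T" using T by (simp add: analytic_C0_semigroup_def)
  obtain \<theta> S where \<theta>: "0 < \<theta>" "\<theta> \<le> pi / 2"
    and S: "\<And>t. 0 \<le> t \<Longrightarrow> S (complex_of_real t) = T t"
    and hol: "holomorphic_operator_family S (sector \<theta>)"
    using T unfolding analytic_C0_semigroup_def by blast
  obtain \<Omega> where \<Omega>: "open \<Omega>" "convex \<Omega>" "\<Omega> \<subseteq> sector \<theta>" "\<And>t. 0 < t \<Longrightarrow> complex_of_real t \<in> \<Omega>"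
    using convex_cone_in_sector[OF \<theta>] by blast
  have pos: "T r x \<in> J" if r: "0 < r" for r
  proof (rule ccontr)
    assume "T r x \<notin> J"
    then obtain f :: "'a \<Rightarrow> complex"
      where f: "bounded_linear f" "\<And>c x. f (c *\<^sub>C x) = c * f x" "\<And>x. x \<in> J \<Longrightarrow> f x = 0"
        "f (T r x) \<noteq> 0"
      using complex_separating_functional[OF J] by metis
    have "f (S (complex_of_real r) x) = 0"
    proof (rule analytic_continuation[where f = "\<lambda>z. f (S z x)" and S = \<Omega>
          and U = "range (\<lambda>n. complex_of_real (\<sigma> n))" and \<xi> = "complex_of_real s"])
      show "(\<lambda>z. f (S z x)) holomorphic_on \<Omega>"
        unfolding holomorphic_on_def
      proof
        fix z assume "z \<in> \<Omega>"
        then obtain D where D: "(S has_derivative D) (at z)"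
            "\<And>c h y. blinfun_apply (D (c * h)) y = c *\<^sub>C blinfun_apply (D h) y"
          using hol \<Omega>(3) unfolding holomorphic_operator_family_def by blast
        have "((\<lambda>z. f (S z x)) has_derivative (\<lambda>h. f (D h x))) (at z)"
          by (intro bounded_linear.has_derivative[OF f(1)]
              bounded_linear.has_derivative[OF blinfun.bounded_linear_left] D(1))
        \<comment> \<open>Complex linearity in the increment makes the Frechet derivative
          multiplication by a complex number.\<close>
        moreover have "(\<lambda>h. f (D h x)) = (*) (f (D 1 x))"
        proof
          fix h
          show "f (D h x) = f (D 1 x) * h"
            using D(2)[of h 1 x] f(2) by (simp add: mult.commute)
        qed
        ultimately have "((\<lambda>z. f (S z x)) has_field_derivative f (D 1 x)) (at z)"
          by (simp add: has_field_derivative_def)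
        then show "(\<lambda>z. f (S z x)) field_differentiable at z within \<Omega>"
          using field_differentiable_at_within field_differentiable_def by blast
      qed
      show "connected \<Omega>" using \<Omega>(2) by (rule convex_connected)
      show "complex_of_real s islimpt range (\<lambda>n. complex_of_real (\<sigma> n))"
        unfolding islimpt_sequential using s(2,4)
        by (intro exI[of _ "\<lambda>n. complex_of_real (\<sigma> n)"]) (auto intro: tendsto_of_real)
      show "f (S z x) = 0" if "z \<in> range (\<lambda>n. complex_of_real (\<sigma> n))" for z
        using that S mem f(3) less_imp_le[OF s(3)] by auto
    qed (use \<Omega> s r in auto)
    with f(4) S r show False by simp
  qed
  show ?thesis
  proof (cases "t = 0")
    \<comment> \<open>Time 0 is only a boundary point of the cone; strong continuity and closedness
      of \<open>J\<close> cover it.\<close>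
    case True
    then show ?thesis
      using C0 C0_semigroup_limit_mem[OF C0 J(2) pos] by (simp add: C0_semigroup_def)
  qed (use t pos in auto)
qed

text \<open>A tail of the orbit contains times accumulating at a positive point. For
  \<open>J\<close> = \<open>{0}\<close> this yields injectivity of the operators
  \<open>T t\<close>.\<close>

corollary analytic_semigroup_eventually_mem:
  assumes T: "analytic_C0_semigroup T"
    and J: "complex_subspace J" "closed J"
    and mem: "\<And>r. s \<le> r \<Longrightarrow> T r x \<in> J" and t: "0 \<le> t"
  shows "T t x \<in> J"
proof (rule analytic_semigroup_identity[OF T J])
  \<comment> \<open>The limit \<open>\<bar>s\<bar> + 1\<close> is positive and beyond
    \<open>s\<close>, whatever the sign of \<open>s\<close>.\<close>
  show "(\<lambda>n. (\<bar>s\<bar> + 1) + inverse (real (Suc n))) \<longlonglongrightarrow> \<bar>s\<bar> + 1"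
    by (rule LIMSEQ_inverse_real_of_nat_add)
  show "T (\<bar>s\<bar> + 1 + inverse (real (Suc n))) x \<in> J" for n
    by (rule mem) (smt (verit) inverse_nonnegative_iff_nonnegative of_nat_0_le_iff)
qed (use t in \<open>auto simp: add_pos_pos add_nonneg_pos\<close>)

section \<open>Equivalence of the two notions of irreducibility\<close>

lemma irreducible_imp_persistently_irreducible:
  assumes T: "analytic_C0_semigroup T" and irr: "irreducible_semigroup T"
  shows "persistently_irreducible_semigroup T"
  unfolding persistently_irreducible_semigroup_def
proof (intro allI impI)
  fix I assume I: "lattice_ideal I" "closed I"
    and "\<exists>s\<^sub>0\<ge>0. \<forall>t\<ge>s\<^sub>0. blinfun_apply (T t) ` I \<subseteq> I"
  then obtain s where s: "\<forall>t\<ge>s. blinfun_apply (T t) ` I \<subseteq> I" by blast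
  have "T t x \<in> I" if "x \<in> I" "0 \<le> t" for t x
    by (rule analytic_semigroup_eventually_mem[OF T complex_subspace_lattice_ideal I(2), of s])
      (use I(1) s that in auto)
  then show "I = {0} \<or> I = UNIV"
    using irr I unfolding irreducible_semigroup_def by blast
qed

lemma persistently_irreducible_imp_irreducible:
  "persistently_irreducible_semigroup T \<Longrightarrow> irreducible_semigroup T"
  unfolding persistently_irreducible_semigroup_def irreducible_semigroup_def by blast

text \<open>With times \<open>\<tau> n\<close> tending to 0 so fast that the errors \<open>|h - T (\<tau> n) h|\<close> are summable with
  small sum \<open>E\<close>, take \<open>g\<close> to be the positive part of \<open>h - E\<close>.\<close>

lemma orbit_lower_approximation:
  fixes h :: "'a::complex_banach_lattice"
  assumes C0: "C0_semigroup T" and h: "\<And>t. 0 \<le> t \<Longrightarrow> 0 \<le> T t h" and \<epsilon>: "\<epsilon> > 0"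
  obtains g \<tau> where "0 \<le> g" "norm (h - g) \<le> \<epsilon>" "\<And>n. g \<le> T (\<tau> n) h" "\<And>n. 0 < \<tau> n"
    "\<tau> \<longlonglongrightarrow> 0"
proof -
  have lim: "((\<lambda>t. T t h) \<longlongrightarrow> h) (at_right 0)"
    using C0 by (simp add: C0_semigroup_def)
  \<comment> \<open>The tolerances are halved at each step and sum to \<epsilon>; the bound on
    \<open>t\<close> forces the chosen times to tend to 0.\<close>
  have "\<exists>t. 0 < t \<and> t < inverse (real (Suc n)) \<and> dist (T t h) h < \<epsilon> * (1/2) ^ Suc n" for n
  proof -
    have "\<epsilon> * (1/2) ^ Suc n > 0" using \<epsilon> by simp
    then have "\<forall>\<^sub>F t in at_right 0. dist (T t h) h < \<epsilon> * (1/2) ^ Suc n"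
      using lim unfolding tendsto_iff by blast
    moreover have "\<forall>\<^sub>F t in at_right 0. t \<in> {0<..<inverse (real (Suc n))}"
      by (rule eventually_at_right_real) simp
    ultimately have "\<forall>\<^sub>F t in at_right 0. 0 < t \<and> t < inverse (real (Suc n)) \<and>
        dist (T t h) h < \<epsilon> * (1/2) ^ Suc n"
      by eventually_elim auto
    then show ?thesis
      by (rule eventually_happens'[OF trivial_limit_at_right_real])
  qed
  then obtain \<tau> where \<tau>: "\<And>n. 0 < \<tau> n" "\<And>n. \<tau> n < inverse (real (Suc n))"
      "\<And>n. dist (T (\<tau> n) h) h < \<epsilon> * (1/2) ^ Suc n"
    by metis
  have \<tau>_lim: "\<tau> \<longlonglongrightarrow> 0"
    by (rule tendsto_sandwich[OF _ _ tendsto_const LIMSEQ_inverse_real_of_nat])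
      (use \<tau> in \<open>auto intro!: always_eventually less_imp_le\<close>)
  have h0: "0 \<le> h" using h[of 0] C0 by (simp add: C0_semigroup_def)
  define e where "e n = modulus (h - T (\<tau> n) h)" for n
  have e_nonneg: "0 \<le> e n" for n by (simp add: e_def modulus_nonneg)
  have norm_e: "norm (e n) \<le> \<epsilon> * (1/2) ^ Suc n" for n
    using \<tau>(3)[of n] by (simp add: e_def norm_modulus dist_norm norm_minus_commute)
  have sums: "(\<lambda>n. \<epsilon> * (1/2) ^ Suc n) sums (\<epsilon> * 1)"
    by (intro sums_mult power_half_series)
  have e_summable: "summable (\<lambda>n. norm (e n))"
    by (rule summable_comparison_test'[OF sums_summable[OF sums]]) (use norm_e in auto)
  \<comment> \<open>The sum bounds all \<open>e n\<close> at once; a supremum of infinitely many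
    vectors need not exist in a Banach lattice.\<close>
  define E where "E = suminf e"
  have E: "e n \<le> E" "0 \<le> E" for n
    unfolding E_def
    using suminf_nonneg_vec[OF summable_norm_cancel[OF e_summable] e_nonneg] by auto
  have norm_E: "norm E \<le> \<epsilon>"
  proof -
    have "norm E \<le> (\<Sum>n. norm (e n))"
      unfolding E_def by (rule summable_norm[OF e_summable])
    also have "\<dots> \<le> (\<Sum>n. \<epsilon> * (1/2) ^ Suc n)"
      by (intro suminf_le norm_e e_summable sums_summable[OF sums])
    also have "\<dots> = \<epsilon>" using sums_unique[OF sums] by simp
    finally show ?thesis .
  qed
  obtain g where g: "0 \<le> g" "h - E \<le> g" "\<And>u. 0 \<le> u \<Longrightarrow> h - E \<le> u \<Longrightarrow> g \<le> u"
    using positive_part_exists[OF nonneg_real_minus[OF h0 E(2)]] by blast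
  \<comment> \<open>As the least positive upper bound of \<open>h - E\<close>, \<open>g\<close> lies
    below every positive vector above \<open>h - E\<close>.\<close>
  have "g \<le> T (\<tau> n) h" for n
  proof (rule g(3))
    show Th: "0 \<le> T (\<tau> n) h" using h \<tau>(1)[of n] by simp
    have "h - T (\<tau> n) h \<le> e n"
      unfolding e_def by (rule real_le_modulus[OF nonneg_real_minus[OF h0 Th]])
    then have "h - T (\<tau> n) h \<le> E" using E(1)[of n] by (rule order_trans)
    then show "h - E \<le> T (\<tau> n) h" by (simp add: algebra_simps)
  qed
  moreover have "norm (h - g) \<le> \<epsilon>"
  proof -
    have "0 \<le> h - g" using g(3)[OF h0] E(2) by simp
    moreover have "h - g \<le> E" using g(2) by (simp add: algebra_simps)
    ultimately show ?thesis using norm_mono_nonneg norm_E by (meson order_trans)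
  qed
  ultimately show thesis
    using g(1) \<tau>(1) \<tau>_lim by (intro that[of g \<tau>])
qed

text \<open>For \<open>g\<close> below \<open>T (\<tau> n) h\<close>, positivity of
  \<open>T (r - \<tau> n)\<close> puts \<open>T (r - \<tau> n) g\<close> below \<open>T r h\<close>.
  These times accumulate at \<open>r\<close>, so the whole orbit of \<open>g\<close> lies in the
  ideal.\<close>

lemma orbit_in_closed_principal_ideal:
  assumes T: "analytic_C0_semigroup T" and pos: "\<And>t. t\<^sub>0 \<le> t \<Longrightarrow> positive_operator (T t)"
    and h: "\<And>t. 0 \<le> t \<Longrightarrow> 0 \<le> T t h" and r: "0 \<le> t\<^sub>0" "t\<^sub>0 < r" and s: "0 \<le> s"
  shows "T s h \<in> closed_principal_ideal (T r h)" (is "_ \<in> ?J")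
proof -
  have C0: "C0_semigroup T" using T by (simp add: analytic_C0_semigroup_def)
  have "lattice_ideal ?J"
    using h r by (intro lattice_ideal_closed_principal_ideal) simp
  then have J: "complex_subspace ?J" "closed ?J"
    by (auto intro: complex_subspace_lattice_ideal closed_closed_principal_ideal)
  have approx: "\<exists>g. norm (h - g) \<le> \<epsilon> \<and> T s g \<in> ?J" if \<epsilon>: "\<epsilon> > 0" for \<epsilon> :: real
  proof -
    obtain g \<tau> where g: "0 \<le> g" "norm (h - g) \<le> \<epsilon>" "\<And>n. g \<le> T (\<tau> n) h"
      and \<tau>: "\<And>n. 0 < \<tau> n" "\<tau> \<longlonglongrightarrow> 0"
      using orbit_lower_approximation[OF C0 h \<epsilon>] by blast
    \<comment> \<open>Passing to a tail keeps \<open>r - \<tau> n\<close> above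
      \<open>t\<^sub>0\<close>, where the operators are positive; this uses the strict inequality
      \<open>t\<^sub>0 < r\<close>.\<close>
    obtain N where N: "\<And>n. N \<le> n \<Longrightarrow> \<tau> n < r - t\<^sub>0"
      using order_tendstoD(2)[OF \<tau>(2), of "r - t\<^sub>0"] r(2) unfolding eventually_sequentially by auto
    have mem: "T (r - \<tau> (n + N)) g \<in> ?J" for n
    proof (rule le_in_closed_principal_ideal)
      have n: "t\<^sub>0 \<le> r - \<tau> (n + N)" using N[of "n + N"] by simp
      show "0 \<le> T (r - \<tau> (n + N)) g"
        using pos[OF n] g(1) by (simp add: positive_operator_def)
      have "T (r - \<tau> (n + N)) g \<le> T (r - \<tau> (n + N)) (T (\<tau> (n + N)) h)"
        using C0 n r pos[OF n] g(3) by (intro positive_operator_mono) (auto simp: C0_semigroup_def)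
      also have "\<dots> = T r h"
        using C0_semigroup_add[OF C0, of "r - \<tau> (n + N)" "\<tau> (n + N)" h] n r(1) \<tau>(1)[of "n + N"] by simp
      finally show "T (r - \<tau> (n + N)) g \<le> T r h" .
    qed
    have "T s g \<in> ?J"
    proof (rule analytic_semigroup_identity[OF T J _ _ _ _ mem s])
      show "0 < r" using r by simp
      show "(\<lambda>n. r - \<tau> (n + N)) \<longlonglongrightarrow> r"
        using tendsto_diff[OF tendsto_const LIMSEQ_ignore_initial_segment[OF \<tau>(2), of N], of r]
        by simp
      show "0 < r - \<tau> (n + N)" for n using N[of "n + N"] r(1) by simp
      show "r - \<tau> (n + N) \<noteq> r" for n using \<tau>(1)[of "n + N"] by simp
    qed
    with g(2) show ?thesis by blast
  qed
  \<comment> \<open>The approximants now converge to \<open>h\<close>; \<open>T s\<close> is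
    continuous and the ideal is closed.\<close>
  have "\<exists>g. norm (h - g) \<le> inverse (real (Suc n)) \<and> T s g \<in> ?J" for n
    by (rule approx) simp
  then obtain g where g: "\<And>n. norm (h - g n) \<le> inverse (real (Suc n))" "\<And>n. T s (g n) \<in> ?J"
    by metis
  have "(\<lambda>n. h - g n) \<longlonglongrightarrow> 0"
    by (rule Lim_null_comparison[OF _ LIMSEQ_inverse_real_of_nat]) (use g(1) in auto)
  then have "(\<lambda>n. h - (h - g n)) \<longlonglongrightarrow> h - 0"
    by (intro tendsto_diff tendsto_const)
  then have "(\<lambda>n. T s (g n)) \<longlonglongrightarrow> T s h"
    by (intro blinfun.tendsto tendsto_const) simp
  with J(2) g(2) show ?thesis
    by (rule closed_sequentially)
qed

theorem proposition3p12:
  fixes T :: "real \<Rightarrow> 'a::complex_banach_lattice \<Rightarrow>\<^sub>L 'a" and t\<^sub>0 :: real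
  assumes "analytic_C0_semigroup T"
    and "uniformly_eventually_positive T"
    and "0 \<le> t\<^sub>0"
    and "\<forall>t\<ge>t\<^sub>0. positive_operator (T t)"
  shows "(irreducible_semigroup T \<longleftrightarrow> persistently_irreducible_semigroup T) \<and>
    (irreducible_semigroup T \<or> persistently_irreducible_semigroup T \<longrightarrow>
      (\<forall>f t. 0 \<le> f \<longrightarrow> f \<noteq> 0 \<longrightarrow> 2 * t\<^sub>0 < t \<longrightarrow> quasi_interior (blinfun_apply (T t) f)))"
proof -
  note T = assms(1) and t0 = assms(3) and pos = assms(4)[rule_format]
  have C0: "C0_semigroup T" using T by (simp add: analytic_C0_semigroup_def)
  have equiv: "irreducible_semigroup T \<longleftrightarrow> persistently_irreducible_semigroup T"
    using irreducible_imp_persistently_irreducible[OF T]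
      persistently_irreducible_imp_irreducible by blast
  have "quasi_interior (T t f)"
    if irr: "persistently_irreducible_semigroup T" and f: "0 \<le> f" "f \<noteq> 0" and t: "2 * t\<^sub>0 < t" for f t
  proof -
    \<comment> \<open>The time \<open>t\<close> is split in two: the first \<open>t\<^sub>0\<close>
      makes the orbit of \<open>h\<close> positive from time 0 on, and the remainder
      \<open>t - t\<^sub>0\<close> still exceeds \<open>t\<^sub>0\<close>.\<close>
    define h where "h = T t\<^sub>0 f"
    have T_add: "T s (T t x) = T (s + t) x" if "0 \<le> s" "0 \<le> t" for s t x
      using C0_semigroup_add[OF C0 that] by simp
    have h: "0 \<le> T s h" if "0 \<le> s" for s
      using pos[of "s + t\<^sub>0"] f(1) that t0 by (simp add: h_def T_add positive_operator_def)
    have u_eq: "T t f = T (t - t\<^sub>0) h"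
      using t t0 by (simp add: h_def T_add)
    let ?J = "closed_principal_ideal (T t f)"
    have u: "0 \<le> T t f" using h t t0 by (simp add: u_eq)
    have "T t f \<noteq> 0"
    proof
      assume "T t f = 0"
      \<comment> \<open>An orbit that vanishes once vanishes from then on, hence at time 0 by
        analyticity.\<close>
      then have "T s f \<in> {0}" if "t \<le> s" for s
        using T_add[of "s - t" t f] that t t0 by simp
      then have "T 0 f \<in> {0}"
        using analytic_semigroup_eventually_mem[OF T complex_subspace_zero closed_singleton] by blast
      with f(2) C0 show False by (simp add: C0_semigroup_def)
    qed
    moreover have "T t f \<in> ?J"
      using u by (rule le_in_closed_principal_ideal) simp
    ultimately have "?J \<noteq> {0}" by auto
    have "T s x \<in> ?J" if s: "t\<^sub>0 \<le> s" and x: "x \<in> ?J" for s x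
    proof (rule closed_principal_ideal_invariant[OF pos[OF s] _ _ u x])
      show "complex_linear (T s)" using C0 s t0 by (simp add: C0_semigroup_def)
      \<comment> \<open>The vector \<open>T s (T t f)\<close> is a later point on the orbit of
        \<open>h\<close>, and that whole orbit lies in the ideal.\<close>
      have "T (s + (t - t\<^sub>0)) h \<in> closed_principal_ideal (T (t - t\<^sub>0) h)"
        using s t t0 by (intro orbit_in_closed_principal_ideal[OF T pos h t0]) auto
      then show "T s (T t f) \<in> ?J"
        using s t t0 by (simp add: u_eq T_add)
    qed
    then have "?J = UNIV"
      using irr \<open>?J \<noteq> {0}\<close> lattice_ideal_closed_principal_ideal[OF u]
        closed_closed_principal_ideal[of "T t f"] t0
      unfolding persistently_irreducible_semigroup_def by (metis image_subsetI)
    with u show ?thesis by (rule quasi_interior_if_closed_principal_ideal)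
  qed
  with equiv show ?thesis by blast
qed

end
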